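(* Assume that $(\mathbb{K}_h,\rho_h)$ is a complete metric space and that there is a function $R\mapsto C_R$ as in the context such that $\rho_h(x^*,(x+th)^* )\le C_R^2\,t$ for all $t>0$, all $R\in[1,\infty]$ and all $x\in\mathbb{K}$ with $h\le x\le Rh$. Let $\{x_n\}_{n\ge1}$ be a sequence in $\mathbb{K}$. Assume that there exist an integer $k\ge1$ and $0<a\le b\le\infty$ ($a$ finite) such that $C_{b/a}<a$ and, for all $n\ge1$, $$x_n+[x_{n+1},\dots,x_{n+2k}]\ge ah,\qquad x_n+[x_{n+1},\dots,x_{n+2k-1}]\le bh .$$ If, for some integer $l\ge0$, $$\limsup_{n\to\infty}\rho_h\big([x_{n-2k-l+1},\dots,x_n],[x_{n-2k-l+1},\dots,x_{n+1}]\big)<\infty,$$ then the continued fraction $z_n=[x_1,\dots,x_n]$ converges in $\rho_h$ to some $z\in\mathbb{K}_h$.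
   Context: $\mathbb{K}$ is a partially ordered abelian semigroup with neutral element $\mathbf{e}$ such that $\mathbf{e}\le x$ for all $x\in\mathbb{K}$ and $x\le y$ implies $x+z\le y+z$ (in particular $y=x+z$ implies $x\le y$). It is equipped with an order reversing involution $x\mapsto x^*$: $x^{**}=x$, and $x\le y$ implies $y^*\le x^*$ (the involution need not commute with addition). Approximants are defined by $[x_1]=x_1^*$ and $[x_1,\dots,x_{n+1}]=(x_1+[x_2,\dots,x_{n+1}])^*$, $n\ge1$. $\mathbb{K}$ has a scaling $x\mapsto ax$ by reals $a>0$ with $1x=x$, $a(bx)=(ab)x$, $a(x+y)=ax+ay$, $(a+b)x=ax+bx$, $x\le y\Rightarrow ax\le ay$, and $(ax)^*=a^{-1}x^*$. A self-polar element $h\in\mathbb{K}$ ($h^*=h$) is fixed; conventions: $0h=\mathbf{e}$, $\infty h=\mathbf{e}^*$. Define $\rho_h(x,y)=\inf\{t\ge0:\ x\le y+th,\ y\le x+th\}$ (with $\inf\emptyset=\infty$) and $\mathbb{K}_h=\{x\in\mathbb{K}: x\le ah\text{ for some }a>0\}$. It is assumed that $\bigcap_{t>0}\{x\in\mathbb{K}: x\le y+th\}=\{x\in\mathbb{K}:x\le y\}$ for all $y\in\mathbb{K}$; then $\rho_h$ is a metric on $\mathbb{K}_h$. $C_R$, $R\in[1,\infty]$, denotes a positive finite function, chosen non-decreasing and right-continuous in $R$; for $b=\infty$, $b/a=\infty$. *)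

theory Defs
  imports "HOL-Analysis.Abstract_Metric_Spaces" "HOL-Library.Extended_Real"
    "HOL-Library.Liminf_Limsup"
begin

text \<open>The neutral element is \<open>0\<close>. All laws for the scaling are required for positive factors
  only; its values at nonpositive factors are unspecified.\<close>

class polar_semigroup = ordered_comm_monoid_add +
  fixes polar :: "'a \<Rightarrow> 'a"
    and pscale :: "real \<Rightarrow> 'a \<Rightarrow> 'a"  (infixr "\<odot>" 75)
  assumes neutral_least: "0 \<le> x"
    and polar_polar: "polar (polar x) = x"
    and polar_antimono: "x \<le> y \<Longrightarrow> polar y \<le> polar x"
    and pscale_one: "1 \<odot> x = x"
    and pscale_pscale: "a > 0 \<Longrightarrow> b > 0 \<Longrightarrow> a \<odot> (b \<odot> x) = (a * b) \<odot> x"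
    and pscale_add_right: "a > 0 \<Longrightarrow> a \<odot> (x + y) = a \<odot> x + a \<odot> y"
    and pscale_add_left: "a > 0 \<Longrightarrow> b > 0 \<Longrightarrow> (a + b) \<odot> x = a \<odot> x + b \<odot> x"
    and pscale_mono: "a > 0 \<Longrightarrow> x \<le> y \<Longrightarrow> a \<odot> x \<le> a \<odot> y"
    and polar_pscale: "a > 0 \<Longrightarrow> polar (a \<odot> x) = inverse a \<odot> polar x"

text \<open>Approximants. Only nonempty lists are meaningful; the value at \<open>[]\<close> is a dummy.\<close>

fun approximant :: "'a::polar_semigroup list \<Rightarrow> 'a" where
  "approximant [] = 0"
| "approximant [x] = polar x"
| "approximant (x # y # ys) = polar (x + approximant (y # ys))"

text \<open>\<open>cfrac x m n\<close> is the approximant of \<open>x m, x (m + 1), \<dots>, x n\<close> (both ends included), for \<open>m \<le> n\<close>.\<close>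

definition cfrac :: "(nat \<Rightarrow> 'a::polar_semigroup) \<Rightarrow> nat \<Rightarrow> nat \<Rightarrow> 'a" where
  "cfrac x m n = approximant (map x [m..<Suc n])"

text \<open>The scaling of \<open>h\<close> extended to factors in \<open>[0, \<infinity>]\<close>.\<close>

definition escale :: "ereal \<Rightarrow> 'a::polar_semigroup \<Rightarrow> 'a" where
  "escale t h = (if t = 0 then 0 else if t = \<infinity> then polar 0 else real_of_ereal t \<odot> h)"

definition rho :: "'a::polar_semigroup \<Rightarrow> 'a \<Rightarrow> 'a \<Rightarrow> ereal" where
  "rho h x y = Inf (ereal ` {t. 0 \<le> t \<and> x \<le> y + escale (ereal t) h \<and> y \<le> x + escale (ereal t) h})"

definition h_bounded :: "'a::polar_semigroup \<Rightarrow> 'a set" where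
  "h_bounded h = {x. \<exists>a>0. x \<le> a \<odot> h}"

text \<open>The library's metric spaces have real-valued distances. On \<open>h_bounded h\<close> the distance
  \<open>rho h\<close> is finite, so nothing is lost there (lemmas \<open>rho_finite\<close> and \<open>Metric_space_rho\<close> below).\<close>

definition rho_real :: "'a::polar_semigroup \<Rightarrow> 'a \<Rightarrow> 'a \<Rightarrow> real" where
  "rho_real h x y = real_of_ereal (rho h x y)"

definition h_archimedean :: "'a::polar_semigroup \<Rightarrow> bool" where
  "h_archimedean h \<longleftrightarrow> (\<forall>y. (\<Inter>t\<in>{0<..}. {x. x \<le> y + t \<odot> h}) = {x. x \<le> y})"

lemma escale_ereal: "escale (ereal t) h = (if t = 0 then 0 else t \<odot> h)"
  by (simp add: escale_def zero_ereal_def)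

lemma rho_nonneg: "0 \<le> rho h x y"
  unfolding rho_def by (rule Inf_greatest) auto

lemma rho_commute: "rho h x y = rho h y x"
  proof -
  have "{t. 0 \<le> t \<and> x \<le> y + escale (ereal t) h \<and> y \<le> x + escale (ereal t) h}
      = {t. 0 \<le> t \<and> y \<le> x + escale (ereal t) h \<and> x \<le> y + escale (ereal t) h}"
    by blast
  then show ?thesis unfolding rho_def by (rule arg_cong)
qed

lemma rho_le:
  assumes "0 \<le> t" "x \<le> y + escale (ereal t) h" "y \<le> x + escale (ereal t) h"
  shows "rho h x y \<le> ereal t"
  unfolding rho_def using assms by (intro Inf_lower) auto

lemma le_add_any: "x \<le> x + (z::'a::polar_semigroup)"
  using add_left_mono[OF neutral_least, of x z] by simp

lemma escale_add: "0 \<le> s \<Longrightarrow> 0 \<le> t \<Longrightarrow> escale (ereal (s + t)) h = escale (ereal s) h + escale (ereal t) h"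
  by (auto simp: escale_ereal pscale_add_left)

lemma escale_mono: "0 \<le> s \<Longrightarrow> s \<le> t \<Longrightarrow> escale (ereal s) h \<le> escale (ereal t) h"
  using escale_add[of s "t - s" h] le_add_any[of "escale (ereal s) h" "escale (ereal (t - s)) h"] by simp

lemma rho_lessD:
  assumes "rho h x y < ereal t"
  shows "x \<le> y + escale (ereal t) h"
proof -
  obtain s where s: "0 \<le> s" "s < t" "x \<le> y + escale (ereal s) h"
    using assms unfolding rho_def Inf_less_iff by auto
  then show ?thesis
    using add_left_mono[OF escale_mono[of s t h], of y] by (meson less_imp_le order_trans)
qed

lemma rho_finite:
  assumes "x \<in> h_bounded h" "y \<in> h_bounded h"
  shows "\<bar>rho h x y\<bar> \<noteq> \<infinity>"
proof -
  obtain a b where ab: "a > 0" "b > 0" "x \<le> a \<odot> h" "y \<le> b \<odot> h"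
    using assms by (auto simp: h_bounded_def)
  have e: "escale (ereal (a + b)) h = a \<odot> h + b \<odot> h"
    using ab by (simp add: escale_ereal pscale_add_left)
  have 1: "x \<le> y + escale (ereal (a + b)) h"
    unfolding e using order_trans[OF ab(3) le_add_any[of "a \<odot> h" "b \<odot> h + y"]] by (simp add: ac_simps)
  have 2: "y \<le> x + escale (ereal (a + b)) h"
    unfolding e using order_trans[OF ab(4) le_add_any[of "b \<odot> h" "a \<odot> h + x"]] by (simp add: ac_simps)
  have "rho h x y \<le> ereal (a + b)"
    using ab by (intro rho_le 1 2) auto
  then show ?thesis using rho_nonneg[of h x y] by auto
qed

lemma rho_triangle: "rho h x z \<le> rho h x y + rho h y z"
proof (rule ereal_le_epsilon2)
  fix e :: real assume e: "0 < e"
  show "rho h x z \<le> rho h x y + rho h y z + ereal e"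
  proof (cases "rho h x y = \<infinity> \<or> rho h y z = \<infinity>")
    case True
    then show ?thesis using rho_nonneg by auto
  next
    case False
    then obtain p q where pq: "rho h x y = ereal p" "rho h y z = ereal q" "0 \<le> p" "0 \<le> q"
      using rho_nonneg[of h x y] rho_nonneg[of h y z] by (cases "rho h x y"; cases "rho h y z") auto
    define s t where "s = p + e / 2" and "t = q + e / 2"
    have st: "0 \<le> s" "0 \<le> t" using pq e by (auto simp: s_def t_def)
    have l: "rho h x y < ereal s" "rho h y x < ereal s" "rho h y z < ereal t" "rho h z y < ereal t"
      using pq e rho_commute[of h y x] rho_commute[of h z y] by (auto simp: s_def t_def)
    note b = l[THEN rho_lessD]
    have 1: "x \<le> z + escale (ereal (s + t)) h"
      using order_trans[OF b(1) add_right_mono[OF b(3)]] st by (simp add: escale_add ac_simps)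
    have 2: "z \<le> x + escale (ereal (s + t)) h"
      using order_trans[OF b(4) add_right_mono[OF b(2)]] st by (simp add: escale_add ac_simps)
    have "rho h x z \<le> ereal (s + t)" using st by (intro rho_le 1 2) auto
    also have "\<dots> = rho h x y + rho h y z + ereal e" by (simp add: pq s_def t_def)
    finally show ?thesis .
  qed
qed

lemma rho_zero_imp_le:
  assumes "h_archimedean h" "rho h x y = 0"
  shows "x \<le> y"
proof -
  have "x \<le> y + t \<odot> h" if "t > 0" for t
    using rho_lessD[of h x y t] assms(2) that by (simp add: escale_ereal)
  then show ?thesis using assms(1) unfolding h_archimedean_def by blast
qed

lemma Metric_space_rho:
  assumes "h_archimedean h"
  shows "Metric_space (h_bounded h) (rho_real h)"
proof
  fix x y z
  show "0 \<le> rho_real h x y" by (simp add: rho_real_def rho_nonneg real_of_ereal_pos)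
  show "rho_real h x y = rho_real h y x" by (simp add: rho_real_def rho_commute[of h x y])
  assume xy: "x \<in> h_bounded h" "y \<in> h_bounded h"
  show "rho_real h x y = 0 \<longleftrightarrow> x = y"
  proof
    assume "rho_real h x y = 0"
    then have "rho h x y = 0"
      using rho_finite[OF xy] by (cases "rho h x y") (auto simp: rho_real_def zero_ereal_def)
    then show "x = y"
      using rho_zero_imp_le[OF assms, of x y] rho_zero_imp_le[OF assms, of y x] rho_commute[of h y x]
      by simp
  next
    assume "x = y"
    then have "rho h x y \<le> ereal 0" using rho_le[of 0 x y h] by (simp add: escale_ereal)
    then show "rho_real h x y = 0"
      using rho_nonneg[of h x y] by (cases "rho h x y") (auto simp: rho_real_def)
  qed
  assume z: "z \<in> h_bounded h"
  show "rho_real h x z \<le> rho_real h x y + rho_real h y z"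
    using rho_triangle[of h x z y] rho_finite[OF xy] rho_finite[OF xy(2) z] rho_finite[OF xy(1) z]
    by (cases "rho h x y"; cases "rho h y z"; cases "rho h x z") (auto simp: rho_real_def)
qed

end

theory Submission
  imports Defs
begin

text \<open>Write \<open>f\<^sub>m y = polar (x m + y)\<close>, so that \<open>cfrac x m n\<close> is
  \<open>f\<^sub>m (f\<^sub>m\<^sub>+\<^sub>1 (\<dots> f\<^sub>n 0))\<close>. Each \<open>f\<^sub>m\<close> is order reversing and \<open>0\<close> is the least element, so
  an approximant with an even (odd) number of terms is a lower (upper) bound for every longer
  approximant with the same first terms (\<open>cfrac_even_terms_le\<close>, \<open>cfrac_odd_terms_ge\<close>). Therefore the two
  hypotheses on blocks of \<open>2 * k\<close> and \<open>2 * k - 1\<close> terms confine \<open>x m + cfrac x (m + 1) n\<close> to the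
  order interval from \<open>a \<odot> h\<close> to \<open>escale b h\<close> as soon as \<open>n \<ge> m + 2 * k\<close>.

  Addition of \<open>x m\<close> does not increase \<open>rho h\<close>. Rescaling the hypothesis on \<open>C\<close> from the interval
  between \<open>h\<close> and \<open>escale (b / a) h\<close> to the interval above shows that \<open>polar\<close> multiplies distances there
  by at most \<open>q = (C (b / a) / a)\<^sup>2 < 1\<close> (\<open>rho_polar_le\<close>): one factor \<open>1 / a\<close> comes from shrinking the
  argument, the other because \<open>polar\<close> inverts the scaling of the value.

  The approximants \<open>z\<^sub>n\<close> and \<open>z\<^sub>n\<^sub>+\<^sub>1\<close> both arise from their tails beginning at \<open>n + 1 - 2 * k - l\<close>, whose
  distance stays bounded as \<open>n\<close> grows, by applying the same \<open>n - 2 * k - l\<close> contractions. So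
  \<open>rho h z\<^sub>n z\<^sub>n\<^sub>+\<^sub>1\<close> decays geometrically, and completeness gives the limit.\<close>

section \<open>Monotonicity of truncated continued fractions\<close>

lemma polar_zero_top: "y \<le> polar (0::'a::polar_semigroup)"
  using polar_antimono[OF neutral_least[of "polar y"]] by (simp add: polar_polar)

lemma cfrac_rec: "m < n \<Longrightarrow> cfrac x m n = polar (x m + cfrac x (Suc m) n)"
  by (simp add: cfrac_def upt_conv_Cons del: upt_Suc)

lemma cfrac_singleton: "cfrac x m m = polar (x m)"
  by (simp add: cfrac_def)

text \<open>The two bounds need each other: prefixing one more term reverses the inequality and changes the
  parity, so they are proved by one induction on the length of the shorter approximant.\<close>

lemma cfrac_truncation:
  "m + d \<le> n \<Longrightarrow>
    (odd d \<longrightarrow> cfrac x m (m + d) \<le> cfrac x m n) \<and> (even d \<longrightarrow> cfrac x m n \<le> cfrac x m (m + d))"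
proof (induction d arbitrary: m)
  case 0
  show ?case
  proof (cases "m = n")
    case False
    then show ?thesis
      using 0 polar_antimono[OF le_add_any[of "x m" "cfrac x (Suc m) n"]]
      by (simp add: cfrac_rec cfrac_singleton)
  qed simp
next
  case (Suc d)
  then show ?case
    using Suc.IH[of "Suc m"] by (auto simp: cfrac_rec intro!: polar_antimono add_left_mono)
qed

lemma cfrac_even_terms_le: "odd d \<Longrightarrow> m + d \<le> n \<Longrightarrow> cfrac x m (m + d) \<le> cfrac x m n"
  and cfrac_odd_terms_ge: "even d \<Longrightarrow> m + d \<le> n \<Longrightarrow> cfrac x m n \<le> cfrac x m (m + d)"
  using cfrac_truncation by blast+

section \<open>Contraction by the polar map\<close>

lemma rho_add_left_le:
  assumes "rho h u v \<le> ereal t"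
  shows "rho h (w + u) (w + v) \<le> ereal t"
proof (rule dense_ge)
  fix r assume "ereal t < r"
  show "rho h (w + u) (w + v) \<le> r"
  proof (cases r)
    case (real s)
    have lt: "rho h u v < ereal s" "rho h v u < ereal s"
      using assms \<open>ereal t < r\<close> real rho_commute[of h v u] by (auto intro: le_less_trans)
    have "0 \<le> s" using rho_nonneg[of h u v] lt(1) by (cases "rho h u v") auto
    then show ?thesis
      using add_left_mono[OF rho_lessD[OF lt(1)], of w] add_left_mono[OF rho_lessD[OF lt(2)], of w]
      by (auto simp: real add.assoc intro!: rho_le)
  qed (use \<open>ereal t < r\<close> in auto)
qed

lemma pscale_inverse_cancel: "0 < a \<Longrightarrow> inverse a \<odot> (a \<odot> y) = y"
  by (simp add: pscale_pscale pscale_one)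

lemma pscale_le_escale_divide:
  assumes "0 < a" "ereal a \<le> b" "p \<le> escale b h"
  shows "inverse a \<odot> p \<le> escale (b / ereal a) h"
proof (cases b)
  case (real s)
  with assms have "inverse a \<odot> p \<le> inverse a \<odot> (s \<odot> h)"
    by (intro pscale_mono) (auto simp: escale_ereal)
  with assms real show ?thesis
    by (simp add: escale_ereal pscale_pscale field_simps)
qed (use assms in \<open>auto simp: escale_def polar_zero_top\<close>)

text \<open>The one-sided form of the contraction estimate. The hypothesis on \<open>c\<close> is applied to
  \<open>inverse a \<odot> p\<close>, which lies above \<open>h\<close>, with increment \<open>s / a\<close>; the conclusion is then scaled back.\<close>

lemma polar_le_polar_add:
  fixes h p u :: "'a::polar_semigroup"
  assumes bound: "\<And>t y. 0 < t \<Longrightarrow> h \<le> y \<Longrightarrow> y \<le> escale (b / ereal a) h \<Longrightarrow>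
      rho h (polar y) (polar (y + t \<odot> h)) \<le> ereal (c\<^sup>2 * t)"
    and ab: "0 < a" "ereal a \<le> b"
    and p: "a \<odot> h \<le> p" "p \<le> escale b h"
    and u: "u \<le> p + s \<odot> h"
    and s: "0 < s" and r: "(c / a)\<^sup>2 * s < r"
  shows "polar p \<le> polar u + r \<odot> h"
proof -
  have r0: "0 < r" using r s by (smt (verit) mult_nonneg_nonneg zero_le_power2)
  define y where "y = inverse a \<odot> p"
  have "h \<le> y"
    using pscale_mono[OF _ p(1), of "inverse a"] ab by (simp add: y_def pscale_inverse_cancel)
  moreover have "y \<le> escale (b / ereal a) h"
    unfolding y_def using ab p by (intro pscale_le_escale_divide)
  ultimately have "rho h (polar y) (polar (y + (s / a) \<odot> h)) \<le> ereal (c\<^sup>2 * (s / a))"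
    using s ab by (intro bound) auto
  also have "\<dots> < ereal (a * r)"
    using r ab by (simp add: power2_eq_square field_simps)
  finally have "polar y \<le> polar (y + (s / a) \<odot> h) + (a * r) \<odot> h"
    using rho_lessD[of h _ _ "a * r"] ab r0 by (simp add: escale_ereal)
  moreover have "y + (s / a) \<odot> h = inverse a \<odot> (p + s \<odot> h)"
    using ab s by (simp add: y_def pscale_add_right pscale_pscale field_simps)
  then have "polar (y + (s / a) \<odot> h) = a \<odot> polar (p + s \<odot> h)"
    using ab by (simp add: polar_pscale)
  moreover have "(a * r) \<odot> h = a \<odot> (r \<odot> h)"
    using ab r0 by (simp add: pscale_pscale)
  ultimately have "a \<odot> polar p \<le> a \<odot> (polar (p + s \<odot> h) + r \<odot> h)"
    using ab by (simp add: y_def polar_pscale pscale_add_right)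
  from pscale_mono[OF _ this, of "inverse a"] have "polar p \<le> polar (p + s \<odot> h) + r \<odot> h"
    using ab by (simp add: pscale_inverse_cancel)
  also have "\<dots> \<le> polar u + r \<odot> h"
    by (intro add_right_mono polar_antimono u)
  finally show ?thesis .
qed

lemma rho_polar_le:
  fixes h p u :: "'a::polar_semigroup"
  assumes bound: "\<And>t y. 0 < t \<Longrightarrow> h \<le> y \<Longrightarrow> y \<le> escale (b / ereal a) h \<Longrightarrow>
      rho h (polar y) (polar (y + t \<odot> h)) \<le> ereal (c\<^sup>2 * t)"
    and ab: "0 < a" "ereal a \<le> b" and c: "0 < c"
    and p: "a \<odot> h \<le> p" "p \<le> escale b h"
    and u: "a \<odot> h \<le> u" "u \<le> escale b h"
    and t: "0 \<le> t" "rho h p u \<le> ereal t"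
  shows "rho h (polar p) (polar u) \<le> ereal ((c / a)\<^sup>2 * t)"
proof (rule ereal_le_epsilon2)
  fix e :: real assume e: "0 < e"
  define q where "q = (c / a)\<^sup>2"
  have q: "0 < q" using ab c by (simp add: q_def)
  \<comment> \<open>Half of \<open>e\<close> covers the passage from \<open>t\<close> to \<open>s\<close>, as the infimum defining \<open>rho\<close> may not be attained;
    the other half makes the inequality for \<open>r\<close> strict.\<close>
  define s where "s = t + e / (2 * q)"
  define r where "r = q * t + e"
  have s: "0 < s" using t e q by (simp add: s_def add_nonneg_pos)
  have r: "q * s < r" "0 < r" using t e q by (auto simp: s_def r_def field_simps add_nonneg_pos add_pos_nonneg)
  have "rho h p u < ereal s" "rho h u p < ereal s"
    using t(2) e q rho_commute[of h u p] by (auto simp: s_def intro: le_less_trans)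
  then have pu: "p \<le> u + s \<odot> h" "u \<le> p + s \<odot> h"
    using rho_lessD s by (fastforce simp: escale_ereal)+
  have "polar p \<le> polar u + r \<odot> h" "polar u \<le> polar p + r \<odot> h"
    using polar_le_polar_add[OF bound ab p pu(2) s] polar_le_polar_add[OF bound ab u pu(1) s] r(1)
    by (auto simp: q_def)
  then have "rho h (polar p) (polar u) \<le> ereal r"
    using r by (intro rho_le) (auto simp: escale_ereal)
  then show "rho h (polar p) (polar u) \<le> ereal ((c / a)\<^sup>2 * t) + ereal e"
    by (simp add: r_def q_def)
qed

section \<open>Convergence\<close>

text \<open>The partial sums of the geometric series are kept exact, in the form \<open>B * (q ^ n - q ^ (n + j))\<close>, so
  that the bound on \<open>d (\<sigma> n) (\<sigma> (n + j))\<close> goes through by induction on \<open>j\<close>.\<close>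

lemma (in Metric_space) MCauchy_geometric:
  assumes \<sigma>: "range \<sigma> \<subseteq> M"
    and step: "\<And>n. d (\<sigma> n) (\<sigma> (Suc n)) \<le> B * q ^ n"
    and q: "0 \<le> q" "q < 1"
  shows "MCauchy \<sigma>"
proof -
  have B: "0 \<le> B" using order_trans[OF nonneg step[of 0]] by simp
  have *: "(1 - q) * d (\<sigma> n) (\<sigma> (n + j)) \<le> B * (q ^ n - q ^ (n + j))" for n j
  proof (induction j)
    case 0
    then show ?case using \<sigma> by (simp add: range_subsetD)
  next
    case (Suc j)
    have "d (\<sigma> n) (\<sigma> (n + Suc j)) \<le> d (\<sigma> n) (\<sigma> (n + j)) + B * q ^ (n + j)"
      using triangle[of "\<sigma> n" "\<sigma> (n + j)" "\<sigma> (n + Suc j)"] step[of "n + j"] \<sigma>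
      by (auto simp: range_subsetD)
    then have "(1 - q) * d (\<sigma> n) (\<sigma> (n + Suc j))
        \<le> (1 - q) * d (\<sigma> n) (\<sigma> (n + j)) + (1 - q) * (B * q ^ (n + j))"
      using q by (metis diff_ge_0_iff_ge distrib_left less_imp_le mult_left_mono)
    also have "\<dots> \<le> B * (q ^ n - q ^ (n + Suc j))"
      using Suc.IH by (simp add: algebra_simps)
    finally show ?case .
  qed
  have tail: "d (\<sigma> n) (\<sigma> n') \<le> B / (1 - q) * q ^ N" if "N \<le> n" "n \<le> n'" for N n n'
  proof -
    have "q ^ n \<le> q ^ N" "0 \<le> q ^ n'"
      using that q by (auto intro: power_decreasing)
    then have "B * (q ^ n - q ^ n') \<le> B * q ^ N"
      using B by (intro mult_left_mono) linarith+
    then show ?thesis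
      using *[of n "n' - n"] that q by (simp add: field_simps)
  qed
  show ?thesis
    unfolding MCauchy_def
  proof (intro conjI \<sigma> allI impI)
    fix e :: real assume "0 < e"
    have "(\<lambda>N. B / (1 - q) * q ^ N) \<longlonglongrightarrow> B / (1 - q) * 0"
      using q by (intro tendsto_intros LIMSEQ_power_zero) auto
    then have "\<forall>\<^sub>F N in sequentially. B / (1 - q) * q ^ N < e"
      using \<open>0 < e\<close> by (intro order_tendstoD) auto
    then obtain N where N: "B / (1 - q) * q ^ N < e"
      by (auto simp: eventually_sequentially)
    have "d (\<sigma> n) (\<sigma> n') < e" if "N \<le> n" "N \<le> n'" for n n'
      using tail[of N n n'] tail[of N n' n] N that commute[of "\<sigma> n" "\<sigma> n'"]
      by (cases "n \<le> n'") auto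
    then show "\<exists>N. \<forall>n n'. N \<le> n \<longrightarrow> N \<le> n' \<longrightarrow> d (\<sigma> n) (\<sigma> n') < e" by blast
  qed
qed

theorem theorem3p3:
  fixes h :: "'a::polar_semigroup"
    and C :: "ereal \<Rightarrow> real"
    and x :: "nat \<Rightarrow> 'a"
    and a :: real and b :: ereal
    and k l :: nat
  assumes self_polar: "polar h = h"
    and archimedean: "h_archimedean h"
    and complete: "Metric_space (h_bounded h) (rho_real h)"
      "Metric_space.mcomplete (h_bounded h) (rho_real h)"
    and C_pos: "\<And>R. 1 \<le> R \<Longrightarrow> 0 < C R"
    and C_mono: "mono_on {1..} C"
    and C_right_cont: "\<And>R. 1 \<le> R \<Longrightarrow> (C \<longlongrightarrow> C R) (at_right R)"
    and C_bound: "\<And>R t y. 1 \<le> R \<Longrightarrow> 0 < t \<Longrightarrow> h \<le> y \<Longrightarrow> y \<le> escale R h \<Longrightarrow>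
        rho h (polar y) (polar (y + t \<odot> h)) \<le> ereal ((C R)\<^sup>2 * t)"
    and k: "1 \<le> k"
    and ab: "0 < a" "ereal a \<le> b"
    and C_less: "C (b / ereal a) < a"
    and lower: "\<And>n. 1 \<le> n \<Longrightarrow> a \<odot> h \<le> x n + cfrac x (n + 1) (n + 2 * k)"
    and upper: "\<And>n. 1 \<le> n \<Longrightarrow> x n + cfrac x (n + 1) (n + 2 * k - 1) \<le> escale b h"
    and limsup_finite: "limsup (\<lambda>n. rho h (cfrac x (n + 1 - 2 * k - l) n)
        (cfrac x (n + 1 - 2 * k - l) (n + 1))) < \<infinity>"
  shows "\<exists>z\<in>h_bounded h. (\<lambda>n. rho h (cfrac x 1 n) z) \<longlonglongrightarrow> 0"
proof -
  interpret Metric_space "h_bounded h" "rho_real h" by (rule complete(1))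
  define q where "q = (C (b / ereal a) / a)\<^sup>2"
  define N where "N = 2 * k + l"
  have R: "1 \<le> b / ereal a" using ab by (cases b) auto
  have C0: "0 < C (b / ereal a)" using C_pos[OF R] .
  then have q: "0 < q" "q < 1"
    using C_less ab by (auto simp: q_def power_less_one_iff abs_square_less_1)
  have interval: "a \<odot> h \<le> x m + cfrac x (Suc m) n" "x m + cfrac x (Suc m) n \<le> escale b h"
    if m: "1 \<le> m" "m + 2 * k \<le> n" for m n
  proof -
    \<comment> \<open>A block of \<open>j\<close> terms beginning at \<open>Suc m\<close> ends at \<open>Suc m + (j - 1)\<close>; hence the odd offset
      \<open>2 * k - 1\<close> for the lower bound and the even offset \<open>2 * k - 2\<close> for the upper bound.\<close>
    have "cfrac x (Suc m) (m + 2 * k) \<le> cfrac x (Suc m) n"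
      using cfrac_even_terms_le[of "2 * k - 1" "Suc m" n x] m k by simp
    then show "a \<odot> h \<le> x m + cfrac x (Suc m) n"
      using order_trans[OF lower[OF m(1)] add_left_mono] by simp
    have "Suc m + (2 * k - 2) = m + 2 * k - 1" using k by simp
    then have "cfrac x (Suc m) n \<le> cfrac x (Suc m) (m + 2 * k - 1)"
      using cfrac_odd_terms_ge[of "2 * k - 2" "Suc m" n x] m k by simp
    then show "x m + cfrac x (Suc m) n \<le> escale b h"
      using order_trans[OF add_left_mono upper[OF m(1)]] by simp
  qed
  have contract: "rho h (cfrac x m n) (cfrac x m (Suc n)) \<le> ereal (q * t)"
    if "1 \<le> m" "m + 2 * k \<le> n" "0 \<le> t"
      and "rho h (cfrac x (Suc m) n) (cfrac x (Suc m) (Suc n)) \<le> ereal t" for m n t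
  proof -
    have "rho h (polar (x m + cfrac x (Suc m) n)) (polar (x m + cfrac x (Suc m) (Suc n))) \<le> ereal (q * t)"
      unfolding q_def using that
      by (intro rho_polar_le[OF C_bound[OF R] ab C0] rho_add_left_le interval) auto
    then show ?thesis using that k by (simp add: cfrac_rec[of m])
  qed
  have in_K: "cfrac x 1 n \<in> h_bounded h" if "N < n" for n
  proof -
    have "a \<odot> h \<le> x 1 + cfrac x (Suc 1) n"
      using that by (intro interval) (auto simp: N_def)
    from polar_antimono[OF this] have "cfrac x 1 n \<le> inverse a \<odot> h"
      using that k ab by (simp add: cfrac_rec N_def polar_pscale self_polar)
    then show ?thesis using ab unfolding h_bounded_def by (auto intro!: exI[of _ "inverse a"])
  qed
  obtain B0 where "limsup (\<lambda>n. rho h (cfrac x (n + 1 - 2 * k - l) n)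
      (cfrac x (n + 1 - 2 * k - l) (n + 1))) < ereal B0"
    using limsup_finite ereal_dense2 by blast
  from Limsup_lessD[OF this]
  obtain n0 where n0: "\<And>n. n0 \<le> n \<Longrightarrow> rho h (cfrac x (n + 1 - 2 * k - l) n)
      (cfrac x (n + 1 - 2 * k - l) (n + 1)) < ereal B0"
    by (auto simp: eventually_sequentially)
  define B where "B = max B0 0"
  have tails: "rho h (cfrac x (Suc i) (i + N)) (cfrac x (Suc i) (Suc (i + N))) \<le> ereal B"
    if "n0 \<le> i" for i
  proof -
    have "i + N + 1 - 2 * k - l = Suc i" by (simp add: N_def)
    then have "rho h (cfrac x (Suc i) (i + N)) (cfrac x (Suc i) (Suc (i + N))) < ereal B0"
      using n0[of "i + N"] that by simp
    also have "ereal B0 \<le> ereal B" by (simp add: B_def)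
    finally show ?thesis by (rule less_imp_le)
  qed
  have pull_back: "rho h (cfrac x (Suc i - j) (i + N)) (cfrac x (Suc i - j) (Suc (i + N)))
      \<le> ereal (B * q ^ j)" if "n0 \<le> i" "j \<le> i" for i j
    using that(2)
  proof (induction j)
    case 0
    then show ?case using tails[OF that(1)] by simp
  next
    case (Suc j)
    then have "rho h (cfrac x (i - j) (i + N)) (cfrac x (i - j) (Suc (i + N)))
        \<le> ereal (q * (B * q ^ j))"
      using q by (intro contract) (auto simp: N_def B_def Suc_diff_le)
    then show ?case by (simp add: mult.left_commute)
  qed
  \<comment> \<open>Past index \<open>n0 + 1 + N\<close> all approximants lie in \<open>h_bounded h\<close> and all tails are controlled.\<close>
  define \<sigma> where "\<sigma> n = cfrac x 1 (n + (n0 + 1 + N))" for n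
  have range: "range \<sigma> \<subseteq> h_bounded h" unfolding \<sigma>_def by (intro image_subsetI in_K) simp
  have "MCauchy \<sigma>"
  proof (rule MCauchy_geometric[OF range])
    fix n
    have "rho h (\<sigma> n) (\<sigma> (Suc n)) \<le> ereal (B * q ^ (n + n0 + 1))"
      using pull_back[of "n + n0 + 1" "n + n0 + 1"] by (simp add: \<sigma>_def ac_simps)
    then show "rho_real h (\<sigma> n) (\<sigma> (Suc n)) \<le> B * q ^ (n0 + 1) * q ^ n"
      using rho_nonneg[of h "\<sigma> n" "\<sigma> (Suc n)"] unfolding rho_real_def
      by (cases "rho h (\<sigma> n) (\<sigma> (Suc n))") (auto simp: power_add mult_ac)
  qed (use q in auto)
  then obtain z where "limitin mtopology \<sigma> z sequentially"
    using complete(2) unfolding mcomplete_def by blast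
  then have z: "z \<in> h_bounded h" and lim: "(\<lambda>n. rho_real h (\<sigma> n) z) \<longlonglongrightarrow> 0"
    by (auto simp: limitin_metric_dist_null)
  have "ereal (rho_real h (\<sigma> n) z) = rho h (\<sigma> n) z" for n
    using rho_finite[of "\<sigma> n" h z] range z by (auto simp: rho_real_def ereal_real range_subsetD)
  then have "(\<lambda>n. rho h (\<sigma> n) z) \<longlonglongrightarrow> 0"
    using tendsto_ereal[OF lim] by (simp add: zero_ereal_def)
  then have "(\<lambda>n. rho h (cfrac x 1 n) z) \<longlonglongrightarrow> 0"
    unfolding \<sigma>_def by (rule LIMSEQ_offset)
  with z show ?thesis by blast
qed

end
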